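(* Let $\mathcal{H},\mathcal{K}$ be real or complex Hilbert spaces and let $T$ be a densely defined linear operator from $\mathcal{H}$ to $\mathcal{K}$ (not assumed closed or closable). Let $P$ be the orthogonal projection of $\mathcal{H}\times\mathcal{K}$ onto $\overline{G(T)}$ and set $G_S:=P\langle\mathcal{H}\times\{0\}\rangle=\{P(u,0):u\in\mathcal{H}\}$. Then $G_S$ is the graph of a densely defined closable linear operator $S$ from $\mathcal{H}$ to $\mathcal{K}$ which has the following properties: a) $G_S\subseteq\overline{G(T)}$; b) $\operatorname{ran}S\subseteq\operatorname{dom}T^*$; c) $T^*S$ is a positive selfadjoint extension of $T^*T$. Furthermore, $S$ is the unique linear operator possessing all the properties a)-c); that is, if $R$ is a linear operator from $\mathcal{H}$ to $\mathcal{K}$ with $G(R)\subseteq\overline{G(T)}$, $\operatorname{ran}R\subseteq\operatorname{dom}T^*$ and $T^*R$ a positive selfadjoint extension of $T^*T$, then $R=S$.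
   Context: Linear operators are defined on linear subspaces; products have their natural domains; equality of operators includes equality of domains. $G(T)=\{(h,Th):h\in\operatorname{dom}T\}\subseteq\mathcal{H}\times\mathcal{K}$ is the graph and $\overline{G(T)}$ its closure in the product Hilbert space (not necessarily the graph of an operator). An operator is closable if the closure of its graph is the graph of an operator. $T^*$ is the adjoint of $T$ (possibly not densely defined). An operator $A$ is positive if $(Ah\mid h)\ge 0$ for all $h\in\operatorname{dom}A$; selfadjoint means densely defined with $A^*=A$. *)

theory Defs
  imports "HOL-Analysis.Analysis"
begin

section \<open>Real or complex scalars\<close>

text \<open>
  The class of scalar fields. Up to an isomorphism that preserves the norm and the conjugation,
  its only members are the real and the complex numbers (see \<open>rc_field_cases\<close> below):
  the imaginary unit is \<open>0\<close> in the real case and a square root of \<open>-1\<close> in the complex case.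
\<close>

class rc_field = real_normed_field +
  fixes conj :: "'a \<Rightarrow> 'a"
    and imag_unit :: 'a
  assumes imag_unit: "imag_unit = 0 \<or> imag_unit * imag_unit = - 1"
    and rc_decomp_scaleR: "\<exists>a b. z = a *\<^sub>R 1 + b *\<^sub>R imag_unit"
    and conj_decomp_scaleR: "conj (a *\<^sub>R 1 + b *\<^sub>R imag_unit) = a *\<^sub>R 1 - b *\<^sub>R imag_unit"
    and mult_conj_scaleR: "z * conj z = (norm z)\<^sup>2 *\<^sub>R 1"

lemma
  fixes z :: "'s::rc_field"
  shows rc_decomp: "\<exists>a b. z = of_real a + of_real b * imag_unit"
    and conj_decomp: "conj (of_real a + of_real b * imag_unit :: 's) = of_real a - of_real b * imag_unit"
    and mult_conj: "z * conj z = of_real ((norm z)\<^sup>2)"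
  using rc_decomp_scaleR[of z] conj_decomp_scaleR[of a b, where 'a='s] mult_conj_scaleR[of z]
  by (simp_all add: of_real_def)

instantiation real :: rc_field
begin

definition conj_real :: "real \<Rightarrow> real" where "conj_real x = x"

definition imag_unit_real :: real where "imag_unit_real = 0"

instance
  by standard (auto simp: conj_real_def imag_unit_real_def power2_eq_square)

end

instantiation complex :: rc_field
begin

definition conj_complex :: "complex \<Rightarrow> complex" where "conj_complex = cnj"

definition imag_unit_complex :: complex where "imag_unit_complex = \<i>"

instance
proof
  fix z :: complex
  show "\<exists>a b. z = a *\<^sub>R 1 + b *\<^sub>R imag_unit"
    by (rule exI[of _ "Re z"], rule exI[of _ "Im z"])
      (simp add: imag_unit_complex_def complex_eq_iff)
  show "z * conj z = (norm z)\<^sup>2 *\<^sub>R 1"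
    by (simp add: conj_complex_def scaleR_conv_of_real complex_norm_square[symmetric])
qed (auto simp: conj_complex_def imag_unit_complex_def)

end

lemma rc_field_cases:
  fixes dummy :: "'s::rc_field itself"
  obtains (real) \<phi> :: "real \<Rightarrow> 's"
    where "bij \<phi>" "\<phi> 1 = 1" "\<And>x y. \<phi> (x + y) = \<phi> x + \<phi> y" "\<And>x y. \<phi> (x * y) = \<phi> x * \<phi> y"
      "\<And>x. norm (\<phi> x) = norm x" "\<And>x. conj (\<phi> x) = \<phi> (conj x)"
  | (complex) \<phi> :: "complex \<Rightarrow> 's"
    where "bij \<phi>" "\<phi> 1 = 1" "\<And>x y. \<phi> (x + y) = \<phi> x + \<phi> y" "\<And>x y. \<phi> (x * y) = \<phi> x * \<phi> y"
      "\<And>x. norm (\<phi> x) = norm x" "\<And>x. conj (\<phi> x) = \<phi> (conj x)"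
proof (cases "imag_unit = (0::'s)")
  case True
  have surj: "surj (of_real :: real \<Rightarrow> 's)"
    using rc_decomp True by (metis add.right_neutral mult_zero_right surj_def)
  have "conj (of_real x :: 's) = of_real (conj x)" for x
    using conj_decomp[where a = x and b = 0 and 's = 's] by (simp add: conj_real_def)
  with surj show ?thesis
    by (intro real[of of_real]) (auto simp: bij_def inj_def)
next
  case False
  define \<phi> :: "complex \<Rightarrow> 's" where "\<phi> z = of_real (Re z) + of_real (Im z) * imag_unit" for z
  have ii: "imag_unit * imag_unit = (- 1 :: 's)"
    using False imag_unit by blast
  have add: "\<phi> (x + y) = \<phi> x + \<phi> y" for x y
    by (simp add: \<phi>_def algebra_simps)
  have mult: "\<phi> (x * y) = \<phi> x * \<phi> y" for x y
  proof -
    have "\<phi> x * \<phi> y = of_real (Re x) * of_real (Re y)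
        + of_real (Im x) * of_real (Im y) * (imag_unit * imag_unit)
        + (of_real (Re x) * of_real (Im y) + of_real (Im x) * of_real (Re y)) * imag_unit"
      by (simp add: \<phi>_def algebra_simps)
    then show ?thesis
      by (simp add: ii) (simp add: \<phi>_def algebra_simps)
  qed
  have cnj: "conj (\<phi> x) = \<phi> (conj x)" for x
    by (simp add: \<phi>_def conj_decomp conj_complex_def)
  have norm: "norm (\<phi> x) = norm x" for x
  proof -
    have "of_real ((norm (\<phi> x))\<^sup>2) = \<phi> x * \<phi> (conj x)"
      by (simp only: cnj[symmetric] mult_conj)
    also have "\<dots> = \<phi> (of_real ((norm x)\<^sup>2))"
      by (simp only: mult[symmetric] mult_conj)
    also have "\<dots> = of_real ((norm x)\<^sup>2)"
      by (simp only: \<phi>_def Re_complex_of_real Im_complex_of_real) simp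
    finally have "(norm (\<phi> x))\<^sup>2 = (norm x)\<^sup>2"
      by (simp only: of_real_eq_iff)
    then show ?thesis by simp
  qed
  have "inj \<phi>"
  proof (rule injI)
    fix x y assume "\<phi> x = \<phi> y"
    then have "\<phi> (x - y) = 0"
      using add[of "x - y" y] by simp
    then show "x = y"
      using norm[of "x - y"] by simp
  qed
  moreover have "surj \<phi>"
    unfolding surj_def
  proof
    fix z :: 's
    obtain a b where "z = of_real a + of_real b * imag_unit"
      using rc_decomp by blast
    then have "z = \<phi> (Complex a b)" by (simp add: \<phi>_def)
    then show "\<exists>x. z = \<phi> x" by blast
  qed
  ultimately show ?thesis
    using add mult cnj norm by (intro complex[of \<phi>]) (auto simp: bij_def \<phi>_def)
qed


section \<open>Hilbert spaces\<close>

text \<open>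
  Completeness and the topology come from the class \<^class>\<open>banach\<close>; its norm is required to be
  the one induced by the inner product, which is linear in the first argument.
\<close>

locale hilbert_space = vector_space scale
  for scale :: "'s::rc_field \<Rightarrow> 'h::banach \<Rightarrow> 'h" +
  fixes ip :: "'h \<Rightarrow> 'h \<Rightarrow> 's"
  assumes scale_of_real: "scale (of_real r) x = r *\<^sub>R x"
    and ip_add_left: "ip (x + y) z = ip x z + ip y z"
    and ip_scale_left: "ip (scale c x) z = c * ip x z"
    and ip_commute: "ip y x = conj (ip x y)"
    and ip_self: "ip x x = of_real ((norm x)\<^sup>2)"

definition prod_scale ::
    "('s \<Rightarrow> 'h \<Rightarrow> 'h) \<Rightarrow> ('s \<Rightarrow> 'k \<Rightarrow> 'k) \<Rightarrow> 's \<Rightarrow> 'h \<times> 'k \<Rightarrow> 'h \<times> 'k" where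
  "prod_scale scaleH scaleK c z = (scaleH c (fst z), scaleK c (snd z))"

definition prod_ip ::
    "('h \<Rightarrow> 'h \<Rightarrow> 's::plus) \<Rightarrow> ('k \<Rightarrow> 'k \<Rightarrow> 's) \<Rightarrow> 'h \<times> 'k \<Rightarrow> 'h \<times> 'k \<Rightarrow> 's" where
  "prod_ip ipH ipK z w = ipH (fst z) (fst w) + ipK (snd z) (snd w)"

lemma conj_add: "conj (x + y) = conj x + conj (y :: 's::rc_field)"
proof -
  obtain a b c d where x: "x = of_real a + of_real b * imag_unit"
    and y: "y = of_real c + of_real d * imag_unit"
    using rc_decomp by metis
  have "x + y = of_real (a + c) + of_real (b + d) * imag_unit"
    by (simp add: x y algebra_simps)
  then have "conj (x + y) = of_real (a + c) - of_real (b + d) * imag_unit"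
    by (simp only: conj_decomp)
  also have "\<dots> = conj x + conj y"
    by (simp only: x y conj_decomp) (simp add: algebra_simps)
  finally show ?thesis .
qed

lemma hilbert_space_prod:
  assumes "hilbert_space scaleH ipH" and "hilbert_space scaleK ipK"
  shows "hilbert_space (prod_scale scaleH scaleK) (prod_ip ipH ipK)"
proof -
  interpret H: hilbert_space scaleH ipH by fact
  interpret K: hilbert_space scaleK ipK by fact
  show ?thesis
  proof
    show "prod_ip ipH ipK y x = conj (prod_ip ipH ipK x y)" for x y
      by (simp add: prod_ip_def conj_add flip: H.ip_commute K.ip_commute)
    show "prod_ip ipH ipK x x = of_real ((norm x)\<^sup>2)" for x
      by (simp add: prod_ip_def norm_prod_def H.ip_self K.ip_self)
  qed (simp_all add: prod_scale_def prod_ip_def prod_eq_iff H.scale_of_real K.scale_of_real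
      H.ip_add_left K.ip_add_left H.ip_scale_left K.ip_scale_left algebra_simps
      H.scale_right_distrib K.scale_right_distrib H.scale_left_distrib K.scale_left_distrib)
qed

definition orth_proj :: "('h \<Rightarrow> 'h \<Rightarrow> 's::zero) \<Rightarrow> 'h::ab_group_add set \<Rightarrow> 'h \<Rightarrow> 'h" where
  "orth_proj ip M x = (THE p. p \<in> M \<and> (\<forall>m\<in>M. ip (x - p) m = 0))"


section \<open>Unbounded operators\<close>

text \<open>
  An operator from \<open>'h\<close> to \<open>'k\<close> is a partial function \<open>'h \<rightharpoonup> 'k\<close>. Then \<^const>\<open>dom\<close>, \<^const>\<open>ran\<close> and
  \<^const>\<open>Map.graph\<close> are its domain, range and graph, \<open>A \<circ>\<^sub>m B\<close> is the product with its natural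
  domain, \<open>A \<subseteq>\<^sub>m B\<close> says that \<open>B\<close> extends \<open>A\<close>, and equality includes equality of domains.
\<close>

definition linear_operator ::
    "('s::rc_field \<Rightarrow> 'h::ab_group_add \<Rightarrow> 'h) \<Rightarrow> ('s \<Rightarrow> 'k::ab_group_add \<Rightarrow> 'k) \<Rightarrow> ('h \<rightharpoonup> 'k) \<Rightarrow> bool" where
  "linear_operator scaleH scaleK T \<longleftrightarrow>
     module.subspace scaleH (dom T) \<and>
     (\<forall>x\<in>dom T. \<forall>y\<in>dom T. the (T (x + y)) = the (T x) + the (T y)) \<and>
     (\<forall>c. \<forall>x\<in>dom T. the (T (scaleH c x)) = scaleK c (the (T x)))"

definition densely_defined :: "('h::topological_space \<rightharpoonup> 'k) \<Rightarrow> bool" where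
  "densely_defined T \<longleftrightarrow> closure (dom T) = UNIV"

definition closable ::
    "('s::rc_field \<Rightarrow> 'h::real_normed_vector \<Rightarrow> 'h) \<Rightarrow> ('s \<Rightarrow> 'k::real_normed_vector \<Rightarrow> 'k) \<Rightarrow>
     ('h \<rightharpoonup> 'k) \<Rightarrow> bool" where
  "closable scaleH scaleK T \<longleftrightarrow>
     (\<exists>C. linear_operator scaleH scaleK C \<and> Map.graph C = closure (Map.graph T))"

text \<open>
  The adjoint is meaningful for densely defined \<open>T\<close>, where the vector \<open>g\<close> below is unique. Its own
  domain need not be dense.
\<close>

definition adjoint_op ::
    "('h \<Rightarrow> 'h \<Rightarrow> 's) \<Rightarrow> ('k \<Rightarrow> 'k \<Rightarrow> 's) \<Rightarrow> ('h \<rightharpoonup> 'k) \<Rightarrow> ('k \<rightharpoonup> 'h)" where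
  "adjoint_op ipH ipK T k =
     (if \<exists>g. \<forall>h\<in>dom T. ipK (the (T h)) k = ipH h g
      then Some (THE g. \<forall>h\<in>dom T. ipK (the (T h)) k = ipH h g)
      else None)"

definition positive_op :: "('h \<Rightarrow> 'h \<Rightarrow> 's::real_algebra_1) \<Rightarrow> ('h \<rightharpoonup> 'h) \<Rightarrow> bool" where
  "positive_op ip A \<longleftrightarrow> (\<forall>h\<in>dom A. ip (the (A h)) h \<in> \<real>\<^sub>\<ge>\<^sub>0)"

definition selfadjoint_op :: "('h \<Rightarrow> 'h \<Rightarrow> 's) \<Rightarrow> ('h::topological_space \<rightharpoonup> 'h) \<Rightarrow> bool" where
  "selfadjoint_op ip A \<longleftrightarrow> densely_defined A \<and> adjoint_op ip ip A = A"

end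

theory Submission
  imports Defs
begin

text \<open>
  The orthogonal complement of the closed graph \<open>M\<close> of \<open>T\<close> consists of the pairs \<open>(-T'b, b)\<close>. Hence
  \<open>P(u, 0) = (x, y)\<close> means that \<open>(x, y) \<in> M\<close>, \<open>y \<in> dom T'\<close> and \<open>u = x + T'y\<close>, so \<open>G\<^sub>S\<close> is the set of
  all \<open>(x, y) \<in> M\<close> with \<open>y \<in> dom T'\<close>. Every \<open>(a, b) \<in> M\<close> satisfies \<open>(a | T'y) = (b | y)\<close>; this makes
  \<open>G\<^sub>S\<close> and its closure single-valued and \<open>T'S\<close> positive and symmetric. Since \<open>I + T'S\<close> is onto,
  \<open>T'S\<close> is selfadjoint. A competitor \<open>R\<close> has its graph inside \<open>G\<^sub>S\<close>, so \<open>T'R\<close> is a restriction of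
  \<open>T'S\<close>; a selfadjoint operator has no proper selfadjoint extension, so the domains agree.
\<close>

section \<open>Geometry of Hilbert spaces\<close>

lemma conj_of_real: "conj (of_real r :: 's::rc_field) = of_real r"
  using conj_decomp[of r 0, where 's = 's] by simp

lemma conj_zero: "conj (0 :: 's::rc_field) = 0"
  using conj_of_real[of 0, where 's = 's] by simp

text \<open>Multiplicativity comes from \<open>mult_conj\<close> and multiplicativity of the norm:
  both sides agree after multiplication by \<open>x * y\<close>, which can be cancelled when
  nonzero.\<close>

lemma conj_mult: "conj (x * y) = conj x * conj (y :: 's::rc_field)"
proof (cases "x * y = 0")
  case True
  then show ?thesis by (auto simp: conj_zero)
next
  case False
  have "(x * y) * conj (x * y) = (x * conj x) * (y * conj y)"
    by (simp only: mult_conj) (simp add: norm_mult power_mult_distrib)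
  then have "(x * y) * conj (x * y) = (x * y) * (conj x * conj y)"
    by (simp add: algebra_simps)
  with False show ?thesis
    by (metis mult_left_cancel)
qed

context hilbert_space
begin

lemma ip_add_right: "ip x (y + z) = ip x y + ip x z"
  by (simp add: ip_commute[of x] ip_add_left conj_add)

lemma ip_scale_right: "ip x (scale c y) = conj c * ip x y"
  by (simp add: ip_commute[of x] ip_scale_left conj_mult)

lemma ip_zero_left [simp]: "ip 0 x = 0"
  using ip_add_left[of 0 0 x] by simp

lemma ip_zero_right [simp]: "ip x 0 = 0"
  using ip_add_right[of x 0 0] by simp

lemma ip_minus_left: "ip (- x) y = - ip x y"
  using ip_add_left[of x "- x" y] by (simp add: eq_neg_iff_add_eq_0 add.commute)

lemma ip_minus_right: "ip x (- y) = - ip x y"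
  using ip_add_right[of x y "- y"] by (simp add: eq_neg_iff_add_eq_0 add.commute)

lemma ip_diff_left: "ip (x - y) z = ip x z - ip y z"
  using ip_add_left[of x "- y" z] by (simp add: ip_minus_left)

lemma ip_diff_right: "ip x (y - z) = ip x y - ip x z"
  using ip_add_right[of x y "- z"] by (simp add: ip_minus_right)

lemma ip_self_eq_0_iff: "ip x x = 0 \<longleftrightarrow> x = 0"
  by (simp add: ip_self)

lemma ip_eq_0_commute: "ip x y = 0 \<longleftrightarrow> ip y x = 0"
  by (metis ip_commute conj_zero)

section \<open>Cauchy-Schwarz and continuity\<close>

lemma norm_scale: "norm (scale c x) = norm c * norm x"
proof -
  have eq: "ip (scale c x) (scale c x) = (c * conj c) * ip x x"
    by (simp add: ip_scale_left ip_scale_right mult.assoc)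
  have "of_real ((norm (scale c x))\<^sup>2) = (of_real ((norm c * norm x)\<^sup>2) :: 's)"
    by (simp only: ip_self[symmetric] eq power_mult_distrib of_real_mult mult_conj[symmetric])
  then have "(norm (scale c x))\<^sup>2 = (norm c * norm x)\<^sup>2"
    by (simp only: of_real_eq_iff)
  then show ?thesis by simp
qed

text \<open>Pythagoras for the component of \<open>d\<close> along \<open>m\<close>. It is used
  twice: nonnegativity of the left side gives Cauchy-Schwarz, and minimality of a distance forces
  \<open>ip d m = 0\<close>.\<close>

lemma norm_diff_proj:
  assumes "m \<noteq> 0"
  shows "(norm (d - scale (ip d m / ip m m) m))\<^sup>2 = (norm d)\<^sup>2 - (norm (ip d m))\<^sup>2 / (norm m)\<^sup>2"
proof -
  define c where "c = ip d m / ip m m"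
  have c: "c * ip m m = ip d m"
    using assms by (simp add: c_def ip_self_eq_0_iff)
  have cd: "c * ip m d = of_real ((norm (ip d m))\<^sup>2 / (norm m)\<^sup>2)"
  proof -
    have "c * ip m d = ip d m * conj (ip d m) / ip m m"
      by (simp add: c_def ip_commute[of m d])
    then show ?thesis
      by (simp only: mult_conj ip_self) simp
  qed
  \<comment> \<open>The terms are grouped so that the last bracket vanishes by the choice of
    \<open>c\<close>.\<close>
  have "ip (d - scale c m) (d - scale c m) = ip d d - c * ip m d - conj c * (ip d m - c * ip m m)"
    by (simp add: ip_diff_left ip_diff_right ip_scale_left ip_scale_right algebra_simps)
  also have "\<dots> = of_real ((norm d)\<^sup>2 - (norm (ip d m))\<^sup>2 / (norm m)\<^sup>2)"
    by (simp only: c cd) (simp add: ip_self)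
  finally show ?thesis
    by (simp only: ip_self of_real_eq_iff c_def)
qed

lemma norm_ip_le: "norm (ip x y) \<le> norm x * norm y"
proof (cases "y = 0")
  case False
  have "0 \<le> (norm x)\<^sup>2 - (norm (ip x y))\<^sup>2 / (norm y)\<^sup>2"
    using norm_diff_proj[OF False, of x] by (metis zero_le_power2)
  then have "(norm (ip x y))\<^sup>2 \<le> (norm x * norm y)\<^sup>2"
    using False by (simp add: field_simps)
  then show ?thesis
    by (rule power2_le_imp_le) simp
qed simp

lemma bounded_linear_ip_left: "bounded_linear (\<lambda>x. ip x y)"
proof (rule bounded_linear_intro)
  show "ip (r *\<^sub>R x) y = r *\<^sub>R ip x y" for r x
    by (simp add: scale_of_real[symmetric] ip_scale_left scaleR_conv_of_real)
  show "norm (ip x y) \<le> norm x * norm y" for x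
    by (rule norm_ip_le)
qed (rule ip_add_left)

lemma bounded_linear_scale: "bounded_linear (scale c)"
proof (rule bounded_linear_intro)
  show "scale c (r *\<^sub>R x) = r *\<^sub>R scale c x" for r x
    by (simp add: scale_of_real[symmetric] mult.commute)
  show "norm (scale c x) \<le> norm x * norm c" for x
    by (simp add: norm_scale)
qed (rule scale_right_distrib)

text \<open>Cauchy-Schwarz makes the inner product continuous, so orthogonality to a closed graph
  can be tested on the graph itself.\<close>

lemma closure_ip_eq_0:
  assumes "x \<in> closure M" and "\<And>m. m \<in> M \<Longrightarrow> ip m y = 0"
  shows "ip x y = 0"
proof -
  have "continuous_on (closure M) (\<lambda>x. ip x y)"
    using bounded_linear_ip_left by (rule linear_continuous_on)
  then show ?thesis
    using assms(2,1) by (rule continuous_constant_on_closure)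
qed

lemma subspace_closure:
  assumes "subspace M"
  shows "subspace (closure M)"
proof (rule subspaceI)
  show "0 \<in> closure M"
    using subspace_0[OF assms] closure_subset by blast
  show "x + y \<in> closure M" if "x \<in> closure M" "y \<in> closure M" for x y
  proof -
    obtain f g where f: "\<And>n. f n \<in> M" "f \<longlonglongrightarrow> x" and g: "\<And>n. g n \<in> M" "g \<longlonglongrightarrow> y"
      using \<open>x \<in> closure M\<close> \<open>y \<in> closure M\<close> unfolding closure_sequential by blast
    have "(\<lambda>n. f n + g n) \<longlonglongrightarrow> x + y"
      using f(2) g(2) by (rule tendsto_add)
    moreover have "\<forall>n. f n + g n \<in> M"
      using f(1) g(1) subspace_add[OF assms] by blast
    ultimately show ?thesis
      unfolding closure_sequential by (intro exI[of _ "\<lambda>n. f n + g n"]) simp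
  qed
  show "scale c x \<in> closure M" if "x \<in> closure M" for c x
  proof -
    obtain f where f: "\<And>n. f n \<in> M" "f \<longlonglongrightarrow> x"
      using \<open>x \<in> closure M\<close> unfolding closure_sequential by blast
    have "(\<lambda>n. scale c (f n)) \<longlonglongrightarrow> scale c x"
      using bounded_linear.tendsto[OF bounded_linear_scale f(2)] .
    moreover have "\<forall>n. scale c (f n) \<in> M"
      using f(1) subspace_scale[OF assms] by blast
    ultimately show ?thesis
      unfolding closure_sequential by (intro exI[of _ "\<lambda>n. scale c (f n)"]) simp
  qed
qed

section \<open>Nearest points and orthogonal projections\<close>

lemma parallelogram:
  fixes x y :: 'h
  shows "(norm (x + y))\<^sup>2 + (norm (x - y))\<^sup>2 = 2 * (norm x)\<^sup>2 + 2 * (norm y)\<^sup>2"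
proof -
  have sum_eq: "ip (x + y) (x + y) + ip (x - y) (x - y) = 2 * ip x x + 2 * ip y y"
    by (simp add: ip_add_left ip_add_right ip_diff_left ip_diff_right)
  have "(of_real ((norm (x + y))\<^sup>2 + (norm (x - y))\<^sup>2) :: 's)
      = of_real (2 * (norm x)\<^sup>2 + 2 * (norm y)\<^sup>2)"
    using sum_eq by (simp only: ip_self of_real_add of_real_mult of_real_numeral)
  then show ?thesis
    by (simp only: of_real_eq_iff)
qed

text \<open>The points of \<open>M\<close> at distance at most \<open>d + \<delta> n\<close> from
  \<open>x\<close> form a decreasing sequence of closed sets. The parallelogram law makes their
  diameters tend to 0, so completeness yields a common point.\<close>

lemma nearest_point_exists:
  assumes "subspace M" and "closed M"
  obtains p where "p \<in> M" and "\<And>m. m \<in> M \<Longrightarrow> norm (x - p) \<le> norm (x - m)"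
proof -
  have ne: "M \<noteq> {}"
    using subspace_0[OF assms(1)] by blast
  define d where "d = infdist x M"
  have d_le: "d \<le> norm (x - m)" if "m \<in> M" for m
    using infdist_le[OF that, of x] by (simp add: d_def dist_norm)
  have d0: "0 \<le> d"
    by (simp add: d_def infdist_nonneg)
  define \<delta> :: "nat \<Rightarrow> real" where "\<delta> n = inverse (Suc n)" for n
  have \<delta>_pos: "\<delta> n > 0" for n
    by (simp add: \<delta>_def)
  define B where "B n = M \<inter> cball x (d + \<delta> n)" for n
  have near: "(norm (p - q))\<^sup>2 \<le> 4 * (d + \<delta> n)\<^sup>2 - 4 * d\<^sup>2" if "p \<in> B n" "q \<in> B n" for p q n
  proof -
    have pq: "p \<in> M" "q \<in> M" "norm (x - p) \<le> d + \<delta> n" "norm (x - q) \<le> d + \<delta> n"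
      using that by (auto simp: B_def dist_norm)
    \<comment> \<open>The midpoint of \<open>p\<close> and \<open>q\<close> stays in
      \<open>M\<close>, hence is no closer to \<open>x\<close> than \<open>d\<close>; this bounds
      the sum term of the parallelogram law from below.\<close>
    have "scale (of_real (1/2)) (p + q) \<in> M"
      using assms(1) pq by (intro subspace_scale subspace_add)
    then have "(1/2) *\<^sub>R (p + q) \<in> M"
      by (simp only: scale_of_real)
    then have "d \<le> norm (x - (1/2) *\<^sub>R (p + q))"
      by (rule d_le)
    then have "2 * d \<le> norm (2 *\<^sub>R (x - (1/2) *\<^sub>R (p + q)))"
      by simp
    also have "2 *\<^sub>R (x - (1/2) *\<^sub>R (p + q)) = (x - p) + (x - q)"
      by (simp add: algebra_simps scaleR_2)
    finally have "(2 * d)\<^sup>2 \<le> (norm ((x - p) + (x - q)))\<^sup>2"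
      using d0 by (intro power_mono) auto
    moreover have "(norm (x - p))\<^sup>2 \<le> (d + \<delta> n)\<^sup>2" "(norm (x - q))\<^sup>2 \<le> (d + \<delta> n)\<^sup>2"
      using pq by (auto intro: power_mono)
    moreover have "norm ((x - p) - (x - q)) = norm (p - q)"
      by (simp add: norm_minus_commute)
    ultimately show ?thesis
      using parallelogram[of "x - p" "x - q"] by (simp add: power_mult_distrib)
  qed
  have lim\<delta>: "\<delta> \<longlonglongrightarrow> 0"
    unfolding \<delta>_def by (rule LIMSEQ_inverse_real_of_nat)
  obtain p where p: "\<And>n. p \<in> B n"
  proof (rule decreasing_closed_nest[of B])
    show "closed (B n)" for n
      using assms(2) by (auto simp: B_def)
    show "B n \<noteq> {}" for n
    proof -
      obtain m where "m \<in> M" "dist x m < d + \<delta> n"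
        using cInf_lessD[of "dist x ` M" "d + \<delta> n"] ne \<delta>_pos[of n]
        by (auto simp: d_def infdist_notempty)
      then show ?thesis by (auto simp: B_def)
    qed
    show "B n \<subseteq> B m" if "m \<le> n" for m n
    proof -
      have "\<delta> n \<le> \<delta> m"
        using that by (simp add: \<delta>_def)
      then show ?thesis by (auto simp: B_def)
    qed
    show "\<exists>n. \<forall>p\<in>B n. \<forall>q\<in>B n. dist p q < e" if "e > 0" for e
    proof -
      have "(\<lambda>n. 4 * (d + \<delta> n)\<^sup>2 - 4 * d\<^sup>2) \<longlonglongrightarrow> 4 * (d + 0)\<^sup>2 - 4 * d\<^sup>2"
        by (intro tendsto_intros lim\<delta>)
      then have "eventually (\<lambda>n. 4 * (d + \<delta> n)\<^sup>2 - 4 * d\<^sup>2 < e\<^sup>2) sequentially"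
        by (rule order_tendstoD) (use that in simp)
      then obtain n where n: "4 * (d + \<delta> n)\<^sup>2 - 4 * d\<^sup>2 < e\<^sup>2"
        by (auto simp: eventually_sequentially)
      have "dist p q < e" if "p \<in> B n" "q \<in> B n" for p q
      proof -
        have "(norm (p - q))\<^sup>2 < e\<^sup>2"
          using near[OF that] n by linarith
        then show ?thesis
          using \<open>e > 0\<close> by (simp add: dist_norm power_less_imp_less_base)
      qed
      then show ?thesis by blast
    qed
  qed blast
  have "norm (x - p) \<le> d"
  proof (rule LIMSEQ_le_const)
    show "(\<lambda>n. d + \<delta> n) \<longlonglongrightarrow> d"
      using tendsto_add[OF tendsto_const lim\<delta>, of d] by simp
    show "\<exists>N. \<forall>n\<ge>N. norm (x - p) \<le> d + \<delta> n"
      using p by (auto simp: B_def dist_norm)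
  qed
  then show thesis
    using p[of 0] d_le by (intro that[of p]) (auto simp: B_def intro: order_trans)
qed

text \<open>At a nearest point \<open>p\<close>, moving along \<open>m\<close> by the component of
  \<open>x - p\<close> would shorten the distance by \<open>norm_diff_proj\<close>, unless that
  component is zero.\<close>

lemma orth_decomposition_exists:
  assumes "subspace M" and "closed M"
  obtains p where "p \<in> M" and "\<And>m. m \<in> M \<Longrightarrow> ip (x - p) m = 0"
proof -
  obtain p where p: "p \<in> M" and min: "\<And>m. m \<in> M \<Longrightarrow> norm (x - p) \<le> norm (x - m)"
    using nearest_point_exists[OF assms] by blast
  have "ip (x - p) m = 0" if "m \<in> M" for m
  proof (cases "m = 0")
    case False
    let ?c = "ip (x - p) m / ip m m"
    have "p + scale ?c m \<in> M"
      using p that assms(1) by (intro subspace_add subspace_scale)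
    from min[OF this] have "norm (x - p) \<le> norm (x - p - scale ?c m)"
      by (simp add: algebra_simps)
    then have "(norm (x - p))\<^sup>2 \<le> (norm (x - p - scale ?c m))\<^sup>2"
      by (rule power_mono) simp
    then have "(norm (ip (x - p) m))\<^sup>2 / (norm m)\<^sup>2 \<le> 0"
      by (simp add: norm_diff_proj[OF False])
    then show ?thesis
      using False by (simp add: divide_le_0_iff)
  qed simp
  with p show thesis by (rule that)
qed

text \<open>This justifies the definite description in \<open>orth_proj\<close>: the difference of
  two candidates lies in \<open>M\<close> and is orthogonal to \<open>M\<close>, hence to
  itself.\<close>

lemma orth_proj_eqI:
  assumes "subspace M" and "p \<in> M" and "\<And>m. m \<in> M \<Longrightarrow> ip (x - p) m = 0"
  shows "orth_proj ip M x = p"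
  unfolding orth_proj_def
proof (rule the_equality)
  fix q assume q: "q \<in> M \<and> (\<forall>m\<in>M. ip (x - q) m = 0)"
  then have "q - p \<in> M"
    using assms by (blast intro: subspace_diff)
  then have "ip (x - p) (q - p) - ip (x - q) (q - p) = 0"
    using q assms(3) by simp
  then have "ip (q - p) (q - p) = 0"
    by (simp add: ip_diff_left)
  then show "q = p"
    by (simp add: ip_self_eq_0_iff)
qed (use assms in blast)

lemma orth_proj:
  assumes "subspace M" and "closed M"
  shows orth_proj_in: "orth_proj ip M x \<in> M"
    and ip_orth_proj: "m \<in> M \<Longrightarrow> ip (x - orth_proj ip M x) m = 0"
proof -
  obtain p where p: "p \<in> M" "\<And>m. m \<in> M \<Longrightarrow> ip (x - p) m = 0"
    using orth_decomposition_exists[OF assms] by blast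
  then show "orth_proj ip M x \<in> M" "m \<in> M \<Longrightarrow> ip (x - orth_proj ip M x) m = 0"
    using orth_proj_eqI[OF assms(1) p] by simp_all
qed

text \<open>The residual of \<open>x\<close> after projection onto \<open>closure M\<close> is
  orthogonal to \<open>M\<close>, so it vanishes. The density of \<open>dom S\<close> is obtained
  this way.\<close>

lemma closure_eq_UNIV_if_orth_trivial:
  assumes "subspace M" and "\<And>z. (\<And>m. m \<in> M \<Longrightarrow> ip z m = 0) \<Longrightarrow> z = 0"
  shows "closure M = UNIV"
proof -
  have "x \<in> closure M" for x
  proof -
    obtain p where p: "p \<in> closure M" "\<And>m. m \<in> closure M \<Longrightarrow> ip (x - p) m = 0"
      using orth_decomposition_exists[OF subspace_closure[OF assms(1)] closed_closure] by blast
    have "x - p = 0"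
      using p(2) closure_subset by (intro assms(2)) blast
    with p(1) show ?thesis by simp
  qed
  then show ?thesis by blast
qed

section \<open>Adjoints and selfadjoint operators\<close>

text \<open>Two representing vectors differ by a vector orthogonal to the dense domain, so
  \<open>g\<close> is unique and the definite description can be eliminated.\<close>

lemma adjoint_op_eq_Some_iff:
  assumes "densely_defined T"
  shows "adjoint_op ip ip' T k = Some g \<longleftrightarrow> (\<forall>h\<in>dom T. ip' (the (T h)) k = ip h g)"
proof -
  have unique: "g1 = g2"
    if "\<forall>h\<in>dom T. ip' (the (T h)) k = ip h g1" "\<forall>h\<in>dom T. ip' (the (T h)) k = ip h g2" for g1 g2
  proof -
    have "g1 - g2 \<in> closure (dom T)"
      using assms by (simp add: densely_defined_def)
    then have "ip (g1 - g2) (g1 - g2) = 0"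
      by (rule closure_ip_eq_0) (use that in \<open>simp add: ip_diff_right\<close>)
    then show ?thesis
      by (simp add: ip_self_eq_0_iff)
  qed
  show ?thesis
  proof (cases "\<exists>g. \<forall>h\<in>dom T. ip' (the (T h)) k = ip h g")
    case True
    then obtain g' where g': "\<forall>h\<in>dom T. ip' (the (T h)) k = ip h g'"
      by blast
    then have "(THE g. \<forall>h\<in>dom T. ip' (the (T h)) k = ip h g) = g'"
      using unique[OF _ g'] by (rule the_equality)
    with True have "adjoint_op ip ip' T k = Some g'"
      unfolding adjoint_op_def by simp
    then show ?thesis
      using g' unique by (metis option.inject)
  next
    case False
    then have "adjoint_op ip ip' T k = None"
      unfolding adjoint_op_def by (rule if_not_P)
    with False show ?thesis
      by (metis option.distinct(1))
  qed
qed

text \<open>Symmetry gives one inclusion. For the other, if the adjoint maps \<open>k\<close> to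
  \<open>g\<close>, solve \<open>x + A x = k + g\<close>; then \<open>k - x\<close> is orthogonal to
  the range of \<open>I + A\<close>, which is the whole space, so \<open>k = x\<close>.\<close>

lemma adjoint_op_eq_self:
  assumes dense: "densely_defined A"
    and sym: "\<And>x y. x \<in> dom A \<Longrightarrow> y \<in> dom A \<Longrightarrow> ip (the (A x)) y = ip x (the (A y))"
    and surj: "\<And>u. \<exists>x\<in>dom A. x + the (A x) = u"
  shows "adjoint_op ip ip A = A"
proof (rule map_le_antisym)
  show "A \<subseteq>\<^sub>m adjoint_op ip ip A"
  proof (unfold map_le_def, rule ballI)
    fix x assume x: "x \<in> dom A"
    then have "adjoint_op ip ip A x = Some (the (A x))"
      unfolding adjoint_op_eq_Some_iff[OF dense] using sym by blast
    with x show "A x = adjoint_op ip ip A x"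
      by (simp add: domIff)
  qed
  show "adjoint_op ip ip A \<subseteq>\<^sub>m A"
  proof (unfold map_le_def, rule ballI)
    fix k assume "k \<in> dom (adjoint_op ip ip A)"
    then obtain g where g: "adjoint_op ip ip A k = Some g"
      by blast
    then have adj: "ip (the (A h)) k = ip h g" if "h \<in> dom A" for h
      using that by (simp add: adjoint_op_eq_Some_iff[OF dense])
    obtain x where x: "x \<in> dom A" "x + the (A x) = k + g"
      using surj by blast
    \<comment> \<open>The second use of surjectivity represents \<open>k - x\<close> itself, so that
      it becomes orthogonal to itself.\<close>
    obtain h where h: "h \<in> dom A" "h + the (A h) = k - x"
      using surj by blast
    have "ip (h + the (A h)) (k - x) = ip h (k + g) - ip h (x + the (A x))"
      using adj[OF h(1)] sym[OF h(1) x(1)]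
      by (simp add: ip_add_left ip_add_right ip_diff_right algebra_simps)
    then have "ip (k - x) (k - x) = 0"
      using x(2) h(2) by simp
    then have "k = x"
      by (simp add: ip_self_eq_0_iff)
    with x g show "adjoint_op ip ip A k = A k"
      by auto
  qed
qed

text \<open>Taking adjoints reverses inclusions: the adjoint relation satisfied by \<open>k\<close>
  on \<open>dom B\<close> restricts to \<open>dom A\<close>, which puts \<open>k\<close> into the
  domain of the adjoint of \<open>A\<close>, that is, of \<open>A\<close>.\<close>

lemma selfadjoint_op_maximal:
  assumes "selfadjoint_op ip A" and "selfadjoint_op ip B" and "A \<subseteq>\<^sub>m B"
  shows "A = B"
proof (rule map_le_antisym[OF assms(3)])
  have A: "densely_defined A" "adjoint_op ip ip A = A"
    and B: "densely_defined B" "adjoint_op ip ip B = B"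
    using assms by (auto simp: selfadjoint_op_def)
  show "B \<subseteq>\<^sub>m A"
  proof (unfold map_le_def, rule ballI)
    fix k assume "k \<in> dom B"
    then obtain g where g: "B k = Some g"
      by blast
    then have "\<forall>h\<in>dom B. ip (the (B h)) k = ip h g"
      using adjoint_op_eq_Some_iff[OF B(1), of ip k g] B(2) by simp
    then have "\<forall>h\<in>dom A. ip (the (A h)) k = ip h g"
      using assms(3) map_le_implies_dom_le[OF assms(3)] by (metis map_le_def subsetD)
    then have "A k = Some g"
      using adjoint_op_eq_Some_iff[OF A(1), of ip k g] A(2) by simp
    with g show "B k = A k" by simp
  qed
qed

end

section \<open>Graphs as subspaces of the product space\<close>

locale hilbert_space_pair =
  H: hilbert_space scaleH ipH + K: hilbert_space scaleK ipK
  for scaleH :: "'s::rc_field \<Rightarrow> 'h::banach \<Rightarrow> 'h" and ipH :: "'h \<Rightarrow> 'h \<Rightarrow> 's"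
    and scaleK :: "'s \<Rightarrow> 'k::banach \<Rightarrow> 'k" and ipK :: "'k \<Rightarrow> 'k \<Rightarrow> 's"
begin

sublocale HK: hilbert_space "prod_scale scaleH scaleK" "prod_ip ipH ipK"
  by (rule hilbert_space_prod) (rule H.hilbert_space_axioms K.hilbert_space_axioms)+

lemma subspace_graph:
  assumes "linear_operator scaleH scaleK T"
  shows "HK.subspace (Map.graph T)"
proof -
  have dom: "H.subspace (dom T)"
    and add: "\<And>x y. x \<in> dom T \<Longrightarrow> y \<in> dom T \<Longrightarrow> the (T (x + y)) = the (T x) + the (T y)"
    and scale: "\<And>c x. x \<in> dom T \<Longrightarrow> the (T (scaleH c x)) = scaleK c (the (T x))"
    using assms by (auto simp: linear_operator_def)
  have graph: "(x, y) \<in> Map.graph T \<longleftrightarrow> x \<in> dom T \<and> y = the (T x)" for x y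
    by (auto simp: Map.graph_def)
  have "the (T 0) = 0"
    using scale[OF H.subspace_0[OF dom], of 0] by simp
  show ?thesis
  proof (rule HK.subspaceI)
    show "0 \<in> Map.graph T"
      using \<open>the (T 0) = 0\<close> H.subspace_0[OF dom] by (simp only: zero_prod_def graph)
    show "z + z' \<in> Map.graph T" if "z \<in> Map.graph T" "z' \<in> Map.graph T" for z z'
      using that H.subspace_add[OF dom]
      by (cases z, cases z') (simp only: add_Pair graph add)
    show "prod_scale scaleH scaleK c z \<in> Map.graph T" if "z \<in> Map.graph T" for c z
      using that H.subspace_scale[OF dom]
      by (cases z) (simp only: prod_scale_def fst_conv snd_conv graph scale)
  qed
qed

text \<open>Two values over the same \<open>x\<close> differ by a value over 0, so it is enough to
  check single-valuedness there. The lemma builds both \<open>S\<close> and its closure.\<close>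

lemma linear_operator_of_graph:
  assumes G: "HK.subspace G" and single: "\<And>y. (0, y) \<in> G \<Longrightarrow> y = 0"
  obtains S where "linear_operator scaleH scaleK S" and "Map.graph S = G"
proof -
  define S where "S x = (if \<exists>y. (x, y) \<in> G then Some (THE y. (x, y) \<in> G) else None)" for x
  have unique: "y = y'" if "(x, y) \<in> G" "(x, y') \<in> G" for x y y'
    using HK.subspace_diff[OF G that] single[of "y - y'"] by simp
  have S: "S x = Some y \<longleftrightarrow> (x, y) \<in> G" for x y
  proof -
    have "(THE y. (x, y) \<in> G) = z" if "(x, z) \<in> G" for z
      using that unique[OF _ that] by (rule the_equality)
    then show ?thesis
      using unique by (auto simp: S_def)
  qed
  then have graph: "Map.graph S = G"
    by (auto simp: Map.graph_def)
  have dom: "dom S = fst ` G"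
    using S by (force simp: dom_def)
  have the_S: "the (S x) = y" if "(x, y) \<in> G" for x y
    using that S by (metis option.sel)
  have add: "(x + x', y + y') \<in> G" if "(x, y) \<in> G" "(x', y') \<in> G" for x x' y y'
    using HK.subspace_add[OF G that] by simp
  have scale: "(scaleH c x, scaleK c y) \<in> G" if "(x, y) \<in> G" for c x y
    using HK.subspace_scale[OF G that] by (simp add: prod_scale_def)
  have "H.subspace (dom S)"
    unfolding dom
  proof (rule H.subspaceI)
    show "0 \<in> fst ` G"
      using HK.subspace_0[OF G] by force
  qed (use add scale in force)+
  then have "linear_operator scaleH scaleK S"
    unfolding linear_operator_def dom
  proof (intro conjI ballI allI)
    fix c x x' assume "x \<in> fst ` G" "x' \<in> fst ` G"
    then obtain y y' where xy: "(x, y) \<in> G" and xy': "(x', y') \<in> G"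
      by auto
    show "the (S (x + x')) = the (S x) + the (S x')"
      by (simp only: the_S[OF xy] the_S[OF xy'] the_S[OF add[OF xy xy']])
  next
    fix c x assume "x \<in> fst ` G"
    then obtain y where xy: "(x, y) \<in> G"
      by auto
    show "the (S (scaleH c x)) = scaleK c (the (S x))"
      by (simp only: the_S[OF xy] the_S[OF scale[OF xy]])
  qed
  then show thesis
    using graph by (rule that)
qed

end

section \<open>The projection of \<open>H \<times> 0\<close> onto the closed graph\<close>

locale dense_operator = hilbert_space_pair scaleH ipH scaleK ipK
  for scaleH :: "'s::rc_field \<Rightarrow> 'h::banach \<Rightarrow> 'h" and ipH :: "'h \<Rightarrow> 'h \<Rightarrow> 's"
    and scaleK :: "'s \<Rightarrow> 'k::banach \<Rightarrow> 'k" and ipK :: "'k \<Rightarrow> 'k \<Rightarrow> 's" +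
  fixes T :: "'h \<rightharpoonup> 'k"
  assumes linear: "linear_operator scaleH scaleK T"
    and dense: "densely_defined T"
begin

abbreviation "M \<equiv> closure (Map.graph T)"
abbreviation "P \<equiv> orth_proj (prod_ip ipH ipK) M"
abbreviation "T' \<equiv> adjoint_op ipH ipK T"

lemma subspace_M: "HK.subspace M"
  using subspace_graph[OF linear] by (rule HK.subspace_closure)

text \<open>Orthogonality of \<open>(a, b)\<close> to the pairs \<open>(h, T h)\<close> is the
  adjoint relation with the sign of \<open>a\<close> reversed; continuity carries it to the
  closure.\<close>

lemma orth_M_iff: "(\<forall>m\<in>M. prod_ip ipH ipK (a, b) m = 0) \<longleftrightarrow> T' b = Some (- a)"
proof
  assume orth: "\<forall>m\<in>M. prod_ip ipH ipK (a, b) m = 0"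
  have "ipK (the (T h)) b = ipH h (- a)" if "h \<in> dom T" for h
  proof -
    have "(h, the (T h)) \<in> Map.graph T"
      using that by (auto simp: Map.graph_def)
    then have "(h, the (T h)) \<in> M"
      using closure_subset by blast
    then have "prod_ip ipH ipK (h, the (T h)) (a, b) = 0"
      using orth HK.ip_eq_0_commute by blast
    then show ?thesis
      by (simp add: prod_ip_def H.ip_minus_right eq_neg_iff_add_eq_0 add.commute)
  qed
  then show "T' b = Some (- a)"
    by (simp add: H.adjoint_op_eq_Some_iff[OF dense])
next
  assume "T' b = Some (- a)"
  then have adj: "\<forall>h\<in>dom T. ipK (the (T h)) b = ipH h (- a)"
    by (simp add: H.adjoint_op_eq_Some_iff[OF dense])
  have "prod_ip ipH ipK m (a, b) = 0" if "m \<in> Map.graph T" for m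
    using adj that by (force simp: Map.graph_def prod_ip_def H.ip_minus_right)
  then show "\<forall>m\<in>M. prod_ip ipH ipK (a, b) m = 0"
    using HK.closure_ip_eq_0 HK.ip_eq_0_commute by blast
qed

text \<open>The adjoint relation survives passage to the closure of the graph, since
  \<open>(- w, z)\<close> is orthogonal to \<open>M\<close>. Single-valuedness, density, positivity
  and symmetry all rest on this identity.\<close>

lemma ip_adjoint:
  assumes "(x, y) \<in> M" and "T' z = Some w"
  shows "ipH x w = ipK y z"
proof -
  have "prod_ip ipH ipK (- w, z) (x, y) = 0"
    using orth_M_iff[of "- w" z] assms by auto
  then have "prod_ip ipH ipK (x, y) (- w, z) = 0"
    by (simp only: HK.ip_eq_0_commute)
  then show ?thesis
    by (simp add: prod_ip_def H.ip_minus_right)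
qed

lemma adjoint_minus: "T' (- y) = Some (- w) \<longleftrightarrow> T' y = Some w"
  by (simp add: H.adjoint_op_eq_Some_iff[OF dense] H.ip_minus_right K.ip_minus_right)

text \<open>The residual \<open>(u - x, - y)\<close> is orthogonal to \<open>M\<close>;
  \<open>orth_M_iff\<close> turns this into a statement about \<open>T'\<close>, and both signs
  cancel.\<close>

lemma P_eq_iff: "P (u, 0) = (x, y) \<longleftrightarrow> (x, y) \<in> M \<and> T' y = Some (u - x)"
proof
  assume P: "P (u, 0) = (x, y)"
  have "\<forall>m\<in>M. prod_ip ipH ipK ((u, 0) - (x, y)) m = 0"
    using HK.ip_orth_proj[OF subspace_M closed_closure, of _ "(u, 0)"] unfolding P by blast
  then have "T' y = Some (u - x)"
    by (simp only: diff_Pair diff_0 orth_M_iff adjoint_minus)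
  then show "(x, y) \<in> M \<and> T' y = Some (u - x)"
    using HK.orth_proj_in[OF subspace_M closed_closure, of "(u, 0)"] unfolding P by blast
next
  assume *: "(x, y) \<in> M \<and> T' y = Some (u - x)"
  then have "\<forall>m\<in>M. prod_ip ipH ipK ((u, 0) - (x, y)) m = 0"
    by (simp only: diff_Pair diff_0 orth_M_iff adjoint_minus)
  then show "P (u, 0) = (x, y)"
    using * HK.orth_proj_eqI[OF subspace_M] by blast
qed

lemma in_image_P_iff: "(x, y) \<in> P ` (UNIV \<times> {0}) \<longleftrightarrow> (x, y) \<in> M \<and> y \<in> dom T'"
proof
  assume "(x, y) \<in> P ` (UNIV \<times> {0})"
  then obtain u where "P (u, 0) = (x, y)"
    by auto
  then show "(x, y) \<in> M \<and> y \<in> dom T'"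
    using P_eq_iff by auto
next
  assume *: "(x, y) \<in> M \<and> y \<in> dom T'"
  then obtain w where "T' y = Some w"
    by blast
  \<comment> \<open>The first component to be projected is forced by \<open>P_eq_iff\<close>: it is
    \<open>x + T' y\<close>.\<close>
  with * have "P (x + w, 0) = (x, y)"
    by (simp add: P_eq_iff)
  then show "(x, y) \<in> P ` (UNIV \<times> {0})"
    by (metis SigmaI UNIV_I imageI singletonI)
qed

lemma image_P_subset: "P ` (UNIV \<times> {0}) \<subseteq> M"
  by (rule subrelI) (simp only: in_image_P_iff)

text \<open>The closure properties are read off the description in \<open>in_image_P_iff\<close>,
  from those of \<open>M\<close> and linearity of the adjoint, rather than from linearity of the
  projection.\<close>

lemma subspace_image_P: "HK.subspace (P ` (UNIV \<times> {0}))"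
proof (rule HK.subspaceI)
  have adj0: "T' 0 = Some 0"
    by (simp add: H.adjoint_op_eq_Some_iff[OF dense])
  then show "0 \<in> P ` (UNIV \<times> {0})"
    using HK.subspace_0[OF subspace_M] unfolding zero_prod_def in_image_P_iff by auto
  show "z + z' \<in> P ` (UNIV \<times> {0})"
    if "z \<in> P ` (UNIV \<times> {0})" "z' \<in> P ` (UNIV \<times> {0})" for z z'
  proof -
    obtain x y x' y' where z: "z = (x, y)" "z' = (x', y')"
      by (cases z, cases z')
    have M: "(x, y) \<in> M" "(x', y') \<in> M" and "y \<in> dom T'" "y' \<in> dom T'"
      using that by (auto simp: z in_image_P_iff)
    then obtain w w' where "T' y = Some w" "T' y' = Some w'"
      by blast
    then have "T' (y + y') = Some (w + w')"
      by (simp add: H.adjoint_op_eq_Some_iff[OF dense] H.ip_add_right K.ip_add_right)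
    then show ?thesis
      using HK.subspace_add[OF subspace_M M] by (auto simp: z in_image_P_iff)
  qed
  show "prod_scale scaleH scaleK c z \<in> P ` (UNIV \<times> {0})"
    if "z \<in> P ` (UNIV \<times> {0})" for c z
  proof -
    obtain x y where z: "z = (x, y)"
      by (cases z)
    have M: "(x, y) \<in> M" and "y \<in> dom T'"
      using that by (auto simp: z in_image_P_iff)
    then obtain w where "T' y = Some w"
      by blast
    then have "T' (scaleK c y) = Some (scaleH c w)"
      by (simp add: H.adjoint_op_eq_Some_iff[OF dense] H.ip_scale_right K.ip_scale_right)
    then show ?thesis
      using HK.subspace_scale[OF subspace_M M, of c]
      by (auto simp: z prod_scale_def in_image_P_iff)
  qed
qed

text \<open>For \<open>(a, b)\<close> in the image, \<open>ip_adjoint\<close> gives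
  \<open>ipK y b = ipH 0 (T' b) = 0\<close>. So \<open>(0, y)\<close> is orthogonal to the image,
  hence to its closure, hence to itself. Working with the closure covers existence and closability
  of \<open>S\<close> together.\<close>

lemma closure_image_P_single_valued:
  assumes "(0, y) \<in> closure (P ` (UNIV \<times> {0}))"
  shows "y = 0"
proof -
  have "(0, y) \<in> M"
    using assms closure_minimal[OF image_P_subset closed_closure] by blast
  then have "prod_ip ipH ipK m (0, y) = 0" if "m \<in> P ` (UNIV \<times> {0})" for m
  proof -
    obtain a b where m: "m = (a, b)"
      by (cases m)
    then obtain w where "T' b = Some w"
      using \<open>m \<in> P ` (UNIV \<times> {0})\<close> by (auto simp: in_image_P_iff)
    then have "ipK y b = 0"
      using ip_adjoint[OF \<open>(0, y) \<in> M\<close>, of b w] by simp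
    then show ?thesis
      by (simp add: m prod_ip_def K.ip_eq_0_commute[of b y])
  qed
  with assms have "prod_ip ipH ipK (0, y) (0, y) = 0"
    by (rule HK.closure_ip_eq_0)
  then show ?thesis
    using HK.ip_self_eq_0_iff by (simp add: zero_prod_def)
qed

lemma exists_operator_of_image_P:
  obtains S where "linear_operator scaleH scaleK S" and "Map.graph S = P ` (UNIV \<times> {0})"
    and "closable scaleH scaleK S"
proof -
  have single: "y = 0" if "(0, y) \<in> P ` (UNIV \<times> {0})" for y
    by (rule closure_image_P_single_valued) (rule subsetD[OF closure_subset that])
  obtain S where S: "linear_operator scaleH scaleK S" "Map.graph S = P ` (UNIV \<times> {0})"
    using linear_operator_of_graph[OF subspace_image_P single] .
  obtain C where C: "linear_operator scaleH scaleK C" "Map.graph C = closure (P ` (UNIV \<times> {0}))"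
    using linear_operator_of_graph[OF HK.subspace_closure[OF subspace_image_P]
      closure_image_P_single_valued] .
  have "closable scaleH scaleK S"
    unfolding closable_def S(2) using C by (intro exI conjI)
  with S show thesis by (rule that)
qed

section \<open>Properties and uniqueness of the operator \<open>S\<close>\<close>

context
  fixes S :: "'h \<rightharpoonup> 'k"
  assumes linear_S: "linear_operator scaleH scaleK S"
    and graph_S: "Map.graph S = P ` (UNIV \<times> {0})"
begin

lemma S_eq_Some_iff: "S x = Some y \<longleftrightarrow> (x, y) \<in> M \<and> y \<in> dom T'"
proof -
  have "S x = Some y \<longleftrightarrow> (x, y) \<in> Map.graph S"
    by (simp add: Map.graph_def)
  then show ?thesis
    by (simp only: graph_S in_image_P_iff)
qed

lemma ran_S: "ran S \<subseteq> dom T'"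
  using S_eq_Some_iff by (auto simp: ran_def)

text \<open>The values of \<open>S\<close> lie in \<open>dom T'\<close>, so the product loses no
  points, and density of its domain reduces to that of \<open>dom S\<close>.\<close>

lemma dom_comp_S: "dom (T' \<circ>\<^sub>m S) = dom S"
  using S_eq_Some_iff by (fastforce simp: map_comp_def dom_def split: option.splits)

lemma comp_SE:
  assumes "x \<in> dom S"
  obtains y w where "(x, y) \<in> M" "T' y = Some w" "(T' \<circ>\<^sub>m S) x = Some w"
proof -
  obtain y where y: "S x = Some y"
    using assms by blast
  then have "(x, y) \<in> M" "y \<in> dom T'"
    by (auto simp: S_eq_Some_iff)
  with y show thesis
    by (auto intro: that)
qed

text \<open>For \<open>z\<close> orthogonal to \<open>dom S\<close>, project \<open>(z, 0)\<close>
  to \<open>(x, y)\<close>. Then \<open>z = x + T' y\<close> with \<open>x\<close> in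
  \<open>dom S\<close>, and \<open>ip_adjoint\<close> shows that the squared norm of
  \<open>(x, y)\<close> equals \<open>ipH x z\<close>, which is 0.\<close>

lemma densely_defined_S: "densely_defined S"
  unfolding densely_defined_def
proof (rule H.closure_eq_UNIV_if_orth_trivial)
  show "H.subspace (dom S)"
    using linear_S by (simp add: linear_operator_def)
  fix z assume orth: "\<And>m. m \<in> dom S \<Longrightarrow> ipH z m = 0"
  obtain x y where xy: "P (z, 0) = (x, y)"
    by (cases "P (z, 0)")
  then have M: "(x, y) \<in> M" and adj: "T' y = Some (z - x)"
    by (simp_all add: P_eq_iff)
  then have "x \<in> dom S"
    using S_eq_Some_iff[of x y] by auto
  then have "ipH z x = 0"
    by (rule orth)
  \<comment> \<open>The vanishing term \<open>ipH x z\<close> is subtracted so that the rest cancels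
    once \<open>ipH x (z - x)\<close> is replaced by \<open>ipK y y\<close>.\<close>
  then have "prod_ip ipH ipK (x, y) (x, y) = ipH x z - ipH x (z - x) + ipK y y - ipH x z"
    using H.ip_eq_0_commute[of x z] by (simp add: prod_ip_def H.ip_diff_right)
  also have "\<dots> = 0"
    using ip_adjoint[OF M adj] by simp
  finally have "x = 0" "y = 0"
    using HK.ip_self_eq_0_iff[of "(x, y)"] by (simp_all add: zero_prod_def)
  moreover have "T' 0 = Some 0"
    by (simp add: H.adjoint_op_eq_Some_iff[OF dense])
  ultimately show "z = 0"
    using adj by simp
qed

text \<open>With \<open>y = S x\<close>, the identity \<open>ip_adjoint\<close> evaluates the form
  at \<open>x\<close> to the squared norm of \<open>y\<close>.\<close>

lemma positive_comp_S: "positive_op ipH (T' \<circ>\<^sub>m S)"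
  unfolding positive_op_def dom_comp_S
proof
  fix x assume "x \<in> dom S"
  then obtain y w where *: "(x, y) \<in> M" "T' y = Some w" "(T' \<circ>\<^sub>m S) x = Some w"
    by (rule comp_SE)
  have "ipH w x = conj (of_real ((norm y)\<^sup>2))"
    using ip_adjoint[OF *(1,2)] by (simp only: H.ip_commute[of w x] K.ip_self)
  then show "ipH (the ((T' \<circ>\<^sub>m S) x)) x \<in> \<real>\<^sub>\<ge>\<^sub>0"
    by (simp only: *(3) option.sel conj_of_real nonneg_Reals_of_real_iff) simp
qed

text \<open>Symmetry follows from \<open>ip_adjoint\<close> applied twice with the two pairs
  exchanged; both forms equal \<open>ipK y y'\<close>.\<close>

lemma selfadjoint_comp_S: "selfadjoint_op ipH (T' \<circ>\<^sub>m S)"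
  unfolding selfadjoint_op_def
proof
  show dense': "densely_defined (T' \<circ>\<^sub>m S)"
    using densely_defined_S by (simp only: densely_defined_def dom_comp_S)
  show "adjoint_op ipH ipH (T' \<circ>\<^sub>m S) = T' \<circ>\<^sub>m S"
  proof (rule H.adjoint_op_eq_self[OF dense'], unfold dom_comp_S)
    fix x x' assume "x \<in> dom S" "x' \<in> dom S"
    obtain y w where *: "(x, y) \<in> M" "T' y = Some w" "(T' \<circ>\<^sub>m S) x = Some w"
      using \<open>x \<in> dom S\<close> by (rule comp_SE)
    obtain y' w' where **: "(x', y') \<in> M" "T' y' = Some w'" "(T' \<circ>\<^sub>m S) x' = Some w'"
      using \<open>x' \<in> dom S\<close> by (rule comp_SE)
    have "ipH w x' = conj (ipK y' y)"
      using ip_adjoint[OF **(1) *(2)] by (simp only: H.ip_commute[of w x'])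
    also have "\<dots> = ipH x w'"
      using ip_adjoint[OF *(1) **(2)] by (simp only: K.ip_commute[of y y'])
    finally show "ipH (the ((T' \<circ>\<^sub>m S) x)) x' = ipH x (the ((T' \<circ>\<^sub>m S) x'))"
      by (simp only: *(3) **(3) option.sel)
  next
    fix u
    \<comment> \<open>Surjectivity of \<open>I + T' S\<close> is the projection itself:
      \<open>P (u, 0) = (x, y)\<close> says that \<open>u = x + T' y\<close> with
      \<open>y = S x\<close>.\<close>
    obtain x y where "P (u, 0) = (x, y)"
      by (cases "P (u, 0)")
    then have *: "(x, y) \<in> M" "T' y = Some (u - x)"
      by (simp_all add: P_eq_iff)
    then have "S x = Some y"
      by (auto simp: S_eq_Some_iff)
    with * show "\<exists>x\<in>dom S. x + the ((T' \<circ>\<^sub>m S) x) = u"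
      by (intro bexI[of _ x]) auto
  qed
qed

text \<open>\<open>S\<close> contains every pair of \<open>M\<close> with second component in
  \<open>dom T'\<close>. This is applied to \<open>T\<close> for the extension property and to a
  competitor for uniqueness.\<close>

lemma S_eq_if_graph_le:
  assumes "Map.graph R \<subseteq> M" and "x \<in> dom R" and "the (R x) \<in> dom T'"
  shows "S x = R x"
proof -
  obtain y where y: "R x = Some y"
    using assms(2) by blast
  then have "(x, y) \<in> M"
    using assms(1) by (auto simp: Map.graph_def)
  with y assms(3) show ?thesis
    by (simp add: S_eq_Some_iff)
qed

lemma comp_S_extends: "T' \<circ>\<^sub>m T \<subseteq>\<^sub>m T' \<circ>\<^sub>m S"
  unfolding map_le_def
proof
  fix x assume "x \<in> dom (T' \<circ>\<^sub>m T)"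
  then have "x \<in> dom T" "the (T x) \<in> dom T'"
    by (auto simp: map_comp_def split: option.splits)
  then have "S x = T x"
    using closure_subset by (intro S_eq_if_graph_le)
  then show "(T' \<circ>\<^sub>m T) x = (T' \<circ>\<^sub>m S) x"
    by (simp add: map_comp_def)
qed

text \<open>\<open>R\<close> is a restriction of \<open>S\<close>, so \<open>T' R\<close> is a
  restriction of \<open>T' S\<close>. Maximality of selfadjoint operators makes these products
  equal, and their domains are those of \<open>R\<close> and \<open>S\<close>.\<close>

lemma S_unique:
  assumes "Map.graph R \<subseteq> M" and ran: "ran R \<subseteq> dom T'" and "selfadjoint_op ipH (T' \<circ>\<^sub>m R)"
  shows "R = S"
proof (rule map_le_antisym)
  have ran': "the (R x) \<in> dom T'" if "x \<in> dom R" for x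
    using that ran by (auto simp: ran_def)
  then have eq: "S x = R x" if "x \<in> dom R" for x
    using S_eq_if_graph_le[OF assms(1) that] that by blast
  then show RS: "R \<subseteq>\<^sub>m S"
    by (simp add: map_le_def)
  have dom_comp_R: "dom (T' \<circ>\<^sub>m R) = dom R"
    using ran' by (fastforce simp: map_comp_def dom_def split: option.splits)
  have "T' \<circ>\<^sub>m R \<subseteq>\<^sub>m T' \<circ>\<^sub>m S"
    unfolding map_le_def dom_comp_R using eq by (simp add: map_comp_def)
  then have "T' \<circ>\<^sub>m R = T' \<circ>\<^sub>m S"
    using assms(3) selfadjoint_comp_S by (intro H.selfadjoint_op_maximal)
  then have "dom R = dom S"
    using dom_comp_R dom_comp_S by metis
  then show "S \<subseteq>\<^sub>m R"
    using eq by (simp add: map_le_def)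
qed

end

end

theorem theorem7p3:
  fixes scaleH :: "'s::rc_field \<Rightarrow> 'h::banach \<Rightarrow> 'h"
    and ipH :: "'h \<Rightarrow> 'h \<Rightarrow> 's"
    and scaleK :: "'s \<Rightarrow> 'k::banach \<Rightarrow> 'k"
    and ipK :: "'k \<Rightarrow> 'k \<Rightarrow> 's"
    and T :: "'h \<rightharpoonup> 'k"
  assumes "hilbert_space scaleH ipH"
    and "hilbert_space scaleK ipK"
    and "linear_operator scaleH scaleK T"
    and "densely_defined T"
  shows "let P = orth_proj (prod_ip ipH ipK) (closure (Map.graph T));
             G\<^sub>S = P ` (UNIV \<times> {0});
             T' = adjoint_op ipH ipK T;
             props = (\<lambda>S. Map.graph S \<subseteq> closure (Map.graph T) \<and>
                          ran S \<subseteq> dom T' \<and>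
                          positive_op ipH (T' \<circ>\<^sub>m S) \<and>
                          selfadjoint_op ipH (T' \<circ>\<^sub>m S) \<and>
                          T' \<circ>\<^sub>m T \<subseteq>\<^sub>m T' \<circ>\<^sub>m S)
         in \<exists>S. linear_operator scaleH scaleK S \<and>
                Map.graph S = G\<^sub>S \<and>
                densely_defined S \<and>
                closable scaleH scaleK S \<and>
                props S \<and>
                (\<forall>R. linear_operator scaleH scaleK R \<and> props R \<longrightarrow> R = S)"
proof -
  interpret dense_operator scaleH ipH scaleK ipK T
    using assms by (intro dense_operator.intro hilbert_space_pair.intro dense_operator_axioms.intro)
  obtain S where S: "linear_operator scaleH scaleK S" "Map.graph S = P ` (UNIV \<times> {0})"
    and closable: "closable scaleH scaleK S"
    by (rule exists_operator_of_image_P)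
  have "Map.graph S \<subseteq> M"
    unfolding S(2) by (rule image_P_subset)
  note facts = this S closable densely_defined_S[OF S] ran_S[OF S] positive_comp_S[OF S]
    selfadjoint_comp_S[OF S] comp_S_extends[OF S]
  show ?thesis
    unfolding Let_def
  proof (intro exI[of _ S] conjI allI impI)
    fix R
    assume "linear_operator scaleH scaleK R \<and> Map.graph R \<subseteq> M \<and> ran R \<subseteq> dom T' \<and>
      positive_op ipH (T' \<circ>\<^sub>m R) \<and> selfadjoint_op ipH (T' \<circ>\<^sub>m R) \<and> T' \<circ>\<^sub>m T \<subseteq>\<^sub>m T' \<circ>\<^sub>m R"
    then show "R = S"
      by (elim conjE) (rule S_unique[OF S])
  qed (rule facts)+
qed

end
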